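(* Let $H\ge 2$ be an even integer and let $r\ge 1$ be an integer. Suppose given $r$ nontrivial 2-phase Golay complementary sequences (pairs) of lengths $s_1,\dots,s_r$ and $r+1$ $H$-phase Golay complementary sequences (pairs) of lengths $t_1,\dots,t_{r+1}$. Then one can construct from them (in particular, there exists) an $H$-phase $(2r+1)$-dimensional Golay complementary array (pair) of size $t_1\times s_1\times t_2\times s_2\times\cdots\times s_r\times t_{r+1}$.
   Context: Let $\xi=e^{2\pi i/H}$. An $H$-phase array of size $n_1\times\cdots\times n_d$ is a $d$-dimensional array $A=(A[i_1,\dots,i_d])$ with $0\le i_k<n_k$ and all entries in $\{1,\xi,\dots,\xi^{H-1}\}$; it is extended by $A[i_1,\dots,i_d]=0$ if some $i_k<0$ or $i_k\ge n_k$. A sequence is a 1-dimensional array; 2-phase means entries in $\{1,-1\}$. The aperiodic autocorrelation is $\mathcal C_A(u_1,\dots,u_d)=\sum_{i_1}\cdots\sum_{i_d}A[i_1,\dots,i_d]\overline{A[i_1+u_1,\dots,i_d+u_d]}$ for integers $u_1,\dots,u_d$. A pair $(A,B)$ of $H$-phase arrays of the same size is a Golay complementary array (GCA) if $\mathcal C_A(u)+\mathcal C_B(u)=0$ for all $u\ne(0,\dots,0)$; a Golay complementary sequence (GCS) is the case $d=1$. A GCS is nontrivial if its length is greater than 1. *)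

theory Defs
  imports "HOL-Analysis.Analysis"
begin

(* A d-dimensional array is a function on integer index tuples, represented as lists of
   length d; its size is the list of the d side lengths. *)

definition index_box :: "nat list \<Rightarrow> int list set" where
  "index_box n = {i. length i = length n \<and> (\<forall>k<length n. 0 \<le> i ! k \<and> i ! k < int (n ! k))}"

definition phases :: "nat \<Rightarrow> complex set" where
  "phases H = {exp (2 * of_real pi * \<i> / of_nat H) ^ k | k. k < H}"

(* The second conjunct is the extension by zero to all integer indices. *)
definition phase_array :: "nat \<Rightarrow> nat list \<Rightarrow> (int list \<Rightarrow> complex) \<Rightarrow> bool" where
  "phase_array H n A \<longleftrightarrow>
     (\<forall>i\<in>index_box n. A i \<in> phases H) \<and> (\<forall>i. i \<notin> index_box n \<longrightarrow> A i = 0)"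

(* The dimension is the length of the shift u. For phase arrays only finitely many summands
   are nonzero, see aperiodic_autocorrelation_eq_sum. *)
definition aperiodic_autocorrelation :: "(int list \<Rightarrow> complex) \<Rightarrow> int list \<Rightarrow> complex" where
  "aperiodic_autocorrelation A u =
     (\<Sum>\<^sub>\<infinity>i\<in>{i. length i = length u}. A i * cnj (A (map2 (+) i u)))"

definition golay_array_pair ::
  "nat \<Rightarrow> nat list \<Rightarrow> (int list \<Rightarrow> complex) \<Rightarrow> (int list \<Rightarrow> complex) \<Rightarrow> bool" where
  "golay_array_pair H n A B \<longleftrightarrow>
     phase_array H n A \<and> phase_array H n B \<and>
     (\<forall>u. length u = length n \<and> u \<noteq> replicate (length n) 0 \<longrightarrow>
        aperiodic_autocorrelation A u + aperiodic_autocorrelation B u = 0)"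

abbreviation golay_sequence_pair ::
  "nat \<Rightarrow> nat \<Rightarrow> (int list \<Rightarrow> complex) \<Rightarrow> (int list \<Rightarrow> complex) \<Rightarrow> bool" where
  "golay_sequence_pair H l A B \<equiv> golay_array_pair H [l] A B"

lemma phases_2: "phases 2 = {1, -1}"
proof -
  have "phases 2 = (\<lambda>k. exp (2 * of_real pi * \<i> / of_nat 2) ^ k) ` {..<2}"
    unfolding phases_def by blast
  also have "{..<2} = {0, 1::nat}" by auto
  finally show ?thesis by simp
qed

lemma finite_index_box: "finite (index_box n)"
proof (rule finite_subset)
  define m where "m = Max (insert 0 (set n))"
  show "index_box n \<subseteq> {i. set i \<subseteq> {0..int m} \<and> length i = length n}"
  proof
    fix i assume i: "i \<in> index_box n"
    have "i ! k \<in> {0..int m}" if "k < length n" for k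
    proof -
      have "n ! k \<le> m" unfolding m_def using that by (intro Max_ge) auto
      then show ?thesis using i that unfolding index_box_def by force
    qed
    then show "i \<in> {i. set i \<subseteq> {0..int m} \<and> length i = length n}"
      using i by (auto simp: index_box_def in_set_conv_nth)
  qed
  show "finite {i. set i \<subseteq> {0..int m} \<and> length i = length n}"
    by (rule finite_lists_length_eq) simp
qed

lemma aperiodic_autocorrelation_eq_sum:
  assumes "phase_array H n A" and "length u = length n"
  shows "aperiodic_autocorrelation A u = (\<Sum>i\<in>index_box n. A i * cnj (A (map2 (+) i u)))"
proof -
  have "aperiodic_autocorrelation A u = (\<Sum>\<^sub>\<infinity>i\<in>index_box n. A i * cnj (A (map2 (+) i u)))"
    unfolding aperiodic_autocorrelation_def
    by (rule infsum_cong_neutral) (use assms in \<open>auto simp: phase_array_def index_box_def\<close>)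
  then show ?thesis by (simp add: finite_index_box)
qed

end

theory Submission
  imports Defs
begin

text \<open>
  Write \<open>X\<^sup>*\<close> for the conjugate reversal of a sequence \<open>X\<close>. For sequences \<open>X, Y\<close> and arrays
  \<open>E, E'\<close> the pair \<open>X \<otimes> E + Y \<otimes> E'\<close>, \<open>- Y\<^sup>* \<otimes> E + X\<^sup>* \<otimes> E'\<close> has as sum of autocorrelations the
  product of the corresponding sums for \<open>(X, Y)\<close> and \<open>(E, E')\<close>: conjugate reversal makes the
  mixed terms cancel. This is used twice. Let \<open>(A, B)\<close> be the 2-phase pair and \<open>(F, G)\<close> the array
  pair already constructed. With \<open>U = (A + B) / 2\<close> and \<open>V = (A - B) / 2\<close>, apply it first to
  \<open>(X, Y) = (U, - V\<^sup>*)\<close> and \<open>(E, E') = ((F + G) / 2, (F - G) / 2)\<close>, and then to the \<open>H\<close>-phase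
  pair \<open>(X, Y) = (C, D)\<close> and the outcome of the first step. The entries remain phases because a
  2-phase Golay pair of length \<open>s > 1\<close> satisfies \<open>a\<^sub>k b\<^sub>k a\<^bsub>s-1-k\<^esub> b\<^bsub>s-1-k\<^esub> = -1\<close>. Hence \<open>U\<close> and \<open>V\<^sup>*\<close>
  share their support, which is complementary to the common support of \<open>V\<close> and \<open>U\<^sup>*\<close>, so that after
  the first step exactly one of the two arrays is nonzero at each index, with value
  \<open>\<plusminus>F\<close> or \<open>\<plusminus>G\<close>.
\<close>

section \<open>Correlations\<close>

lemma index_box_Nil [simp]: "index_box [] = {[]}"
  by (auto simp: index_box_def)

lemma Cons_in_index_box [simp]:
  "k # i \<in> index_box (n # ns) \<longleftrightarrow> 0 \<le> k \<and> k < int n \<and> i \<in> index_box ns"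
  by (auto simp: index_box_def All_less_Suc2)

lemma Nil_notin_index_box [simp]: "[] \<notin> index_box (n # ns)"
  by (simp add: index_box_def)

lemma index_box_Cons:
  "index_box (n # ns) = (\<lambda>(k, i). k # i) ` ({0..<int n} \<times> index_box ns)"
proof (rule set_eqI)
  fix i
  show "i \<in> index_box (n # ns) \<longleftrightarrow> i \<in> (\<lambda>(k, i). k # i) ` ({0..<int n} \<times> index_box ns)"
    by (cases i) force+
qed

lemma sum_index_box_Cons:
  "(\<Sum>i\<in>index_box (n # ns). h i) = (\<Sum>k\<in>{0..<int n}. \<Sum>i\<in>index_box ns. h (k # i))"
  unfolding index_box_Cons
  by (subst sum.reindex) (auto simp: inj_on_def sum.cartesian_product case_prod_unfold)

text \<open>Cross-correlation as a finite sum: confining \<open>i\<close> to the box loses nothing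
  when \<open>X\<close> vanishes off it. Mixed terms of tensor sums call for two arguments.\<close>

definition box_corr ::
  "nat list \<Rightarrow> (int list \<Rightarrow> complex) \<Rightarrow> (int list \<Rightarrow> complex) \<Rightarrow> int list \<Rightarrow> complex" where
  "box_corr ns X Y u = (\<Sum>i\<in>index_box ns. X i * cnj (Y (map2 (+) i u)))"

definition seq_corr :: "nat \<Rightarrow> (int \<Rightarrow> complex) \<Rightarrow> (int \<Rightarrow> complex) \<Rightarrow> int \<Rightarrow> complex" where
  "seq_corr n X Y a = (\<Sum>k\<in>{0..<int n}. X k * cnj (Y (k + a)))"

definition supported :: "nat \<Rightarrow> (int \<Rightarrow> complex) \<Rightarrow> bool" where
  "supported n X \<longleftrightarrow> (\<forall>k. k \<notin> {0..<int n} \<longrightarrow> X k = 0)"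

definition conj_rev :: "nat \<Rightarrow> (int \<Rightarrow> complex) \<Rightarrow> int \<Rightarrow> complex" where
  "conj_rev n X k = cnj (X (int n - 1 - k))"

lemma conj_rev_conj_rev [simp]: "conj_rev n (conj_rev n X) = X"
  by (simp add: conj_rev_def fun_eq_iff)

lemma conj_rev_uminus: "conj_rev n (\<lambda>k. - X k) = (\<lambda>k. - conj_rev n X k)"
  by (simp add: conj_rev_def fun_eq_iff)

lemma supported_conj_rev: "supported n X \<Longrightarrow> supported n (conj_rev n X)"
  by (auto simp: supported_def conj_rev_def)

lemma supported_uminus: "supported n X \<Longrightarrow> supported n (\<lambda>k. - X k)"
  by (auto simp: supported_def)

lemma seq_corr_uminus_left: "seq_corr n (\<lambda>k. - X k) Y a = - seq_corr n X Y a"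
  by (simp add: seq_corr_def sum_negf)

lemma seq_corr_uminus_right: "seq_corr n X (\<lambda>k. - Y k) a = - seq_corr n X Y a"
  by (simp add: seq_corr_def sum_negf)

lemma seq_corr_conj_rev:
  assumes "supported n X" "supported n Y"
  shows "seq_corr n (conj_rev n X) (conj_rev n Y) a = seq_corr n Y X a"
  unfolding seq_corr_def
\<comment> \<open>Where \<open>k + a\<close> leaves the range, both summands vanish by the support
  assumptions. On the remaining indices \<open>k \<mapsto> n - 1 - k - a\<close> is an
  involution.\<close>
proof (rule sum.reindex_bij_witness_not_neutral
    [where S' = "{0..<int n} - {k. k + a \<in> {0..<int n}}"
       and T' = "{0..<int n} - {k. k + a \<in> {0..<int n}}"
       and i = "\<lambda>k. int n - 1 - k - a" and j = "\<lambda>k. int n - 1 - k - a"])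
qed (use assms in \<open>auto simp: supported_def conj_rev_def algebra_simps\<close>)

text \<open>This is \<open>X \<otimes> E + Y \<otimes> E'\<close>, with the new coordinate in front.
  The value 0 at \<open>[]\<close> fits the extension by zero.\<close>

fun tensor_sum ::
  "(int \<Rightarrow> complex) \<Rightarrow> (int list \<Rightarrow> complex) \<Rightarrow> (int \<Rightarrow> complex) \<Rightarrow> (int list \<Rightarrow> complex) \<Rightarrow>
   int list \<Rightarrow> complex" where
  "tensor_sum X E Y E' [] = 0"
| "tensor_sum X E Y E' (k # i) = X k * E i + Y k * E' i"

lemma box_corr_tensor_sum:
  "box_corr (n # ns) (tensor_sum X E Y E') (tensor_sum X E Y E') (a # u) =
     seq_corr n X X a * box_corr ns E E u + seq_corr n X Y a * box_corr ns E E' u +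
     seq_corr n Y X a * box_corr ns E' E u + seq_corr n Y Y a * box_corr ns E' E' u"
  unfolding box_corr_def seq_corr_def sum_index_box_Cons sum_product sum.distrib [symmetric]
  by (intro sum.cong refl) (simp add: algebra_simps)

text \<open>Conjugate reversal swaps the arguments of \<open>seq_corr\<close>, so the coefficient of
  \<open>box_corr ns E E' u\<close> in \<open>Q\<close> is \<open>- seq_corr n X Y a\<close>, which
  cancels the one in \<open>P\<close>; likewise for \<open>E' E\<close>. The diagonal terms
  factor.\<close>

lemma box_corr_tensor_sum_pair:
  fixes E E' :: "int list \<Rightarrow> complex"
  assumes "supported n X" "supported n Y"
  defines "P \<equiv> tensor_sum X E Y E'"
    and "Q \<equiv> tensor_sum (\<lambda>k. - conj_rev n Y k) E (conj_rev n X) E'"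
  shows "box_corr (n # ns) P P (a # u) + box_corr (n # ns) Q Q (a # u) =
    (seq_corr n X X a + seq_corr n Y Y a) * (box_corr ns E E u + box_corr ns E' E' u)"
  unfolding P_def Q_def box_corr_tensor_sum
  using assms(1,2)
  by (simp add: seq_corr_uminus_left seq_corr_uminus_right seq_corr_conj_rev algebra_simps)

lemma box_corr_half_sum_diff:
  "box_corr ns (\<lambda>i. (F i + G i) / 2) (\<lambda>i. (F i + G i) / 2) u +
   box_corr ns (\<lambda>i. (F i - G i) / 2) (\<lambda>i. (F i - G i) / 2) u =
   (box_corr ns F F u + box_corr ns G G u) / 2"
  unfolding box_corr_def sum.distrib [symmetric] sum_divide_distrib
  by (intro sum.cong refl) (simp add: field_simps)

lemma seq_corr_half_sum_diff:
  "seq_corr n (\<lambda>k. (A k + B k) / 2) (\<lambda>k. (A k + B k) / 2) a +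
   seq_corr n (\<lambda>k. (A k - B k) / 2) (\<lambda>k. (A k - B k) / 2) a =
   (seq_corr n A A a + seq_corr n B B a) / 2"
  unfolding seq_corr_def sum.distrib [symmetric] sum_divide_distrib
  by (intro sum.cong refl) (simp add: field_simps)

lemma golay_array_pair_iff:
  "golay_array_pair H n A B \<longleftrightarrow>
     phase_array H n A \<and> phase_array H n B \<and>
     (\<forall>u. length u = length n \<and> u \<noteq> replicate (length n) 0 \<longrightarrow>
        box_corr n A A u + box_corr n B B u = 0)"
  unfolding golay_array_pair_def box_corr_def
  by (auto simp: aperiodic_autocorrelation_eq_sum)

lemma golay_sequence_pairE:
  assumes "golay_sequence_pair H n A B"
  obtains X Y where "supported n X" "supported n Y"
    "\<And>k. k \<in> {0..<int n} \<Longrightarrow> X k \<in> phases H" "\<And>k. k \<in> {0..<int n} \<Longrightarrow> Y k \<in> phases H"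
    "\<And>a. a \<noteq> 0 \<Longrightarrow> seq_corr n X X a + seq_corr n Y Y a = 0"
proof
  have ph: "phase_array H [n] A" "phase_array H [n] B"
    using assms by (auto simp: golay_array_pair_def)
  then show "supported n (\<lambda>k. A [k])" "supported n (\<lambda>k. B [k])"
    by (auto simp: supported_def phase_array_def)
  show "A [k] \<in> phases H" "B [k] \<in> phases H" if "k \<in> {0..<int n}" for k
    using ph that by (auto simp: phase_array_def)
  show "seq_corr n (\<lambda>k. A [k]) (\<lambda>k. A [k]) a + seq_corr n (\<lambda>k. B [k]) (\<lambda>k. B [k]) a = 0"
    if "a \<noteq> 0" for a
  proof -
    have "box_corr [n] A A [a] + box_corr [n] B B [a] = 0"
      using assms that by (auto simp: golay_array_pair_iff)
    then show ?thesis by (simp add: box_corr_def seq_corr_def sum_index_box_Cons)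
  qed
qed

section \<open>Symmetry of 2-phase Golay pairs\<close>

text \<open>A parity count: a vanishing sum of \<open>2 * card I\<close> signs contains exactly
  \<open>card I\<close> signs \<open>-1\<close>.\<close>

lemma prod_eq_if_sum_zero:
  fixes p q :: "'a \<Rightarrow> complex"
  assumes fin: "finite I" and pq: "\<And>i. i \<in> I \<Longrightarrow> p i \<in> {1, -1} \<and> q i \<in> {1, -1}"
    and zero: "(\<Sum>i\<in>I. p i + q i) = 0"
  shows "(\<Prod>i\<in>I. p i * q i) = (-1) ^ card I"
proof -
  \<comment> \<open>Generalised for the induction: a pair of equal signs moves \<open>m\<close> by
    one and has product 1, a pair of opposite signs keeps \<open>m\<close> and has product
    -1.\<close>
  have "\<exists>m::int. (\<Sum>i\<in>I. p i + q i) = 2 * of_int m \<and>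
      (\<Prod>i\<in>I. p i * q i) = (if even m then 1 else -1) * (-1) ^ card I"
    using fin pq
  proof (induction I rule: finite_induct)
    case empty
    show ?case by (rule exI [of _ 0]) simp
  next
    case (insert x I)
    then obtain m :: int where m: "(\<Sum>i\<in>I. p i + q i) = 2 * of_int m"
      "(\<Prod>i\<in>I. p i * q i) = (if even m then 1 else -1) * (-1) ^ card I"
      by auto
    have "p x \<in> {1, -1}" "q x \<in> {1, -1}" using insert.prems by auto
    then consider "p x = 1" "q x = 1" | "p x = -1" "q x = -1" | "p x * q x = -1" "p x + q x = 0"
      by auto
    then show ?case
    proof cases
      case 1
      then show ?thesis using insert.hyps m by (intro exI [of _ "m + 1"]) auto
    next
      case 2
      then show ?thesis using insert.hyps m by (intro exI [of _ "m - 1"]) auto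
    next
      case 3
      then show ?thesis using insert.hyps m by (intro exI [of _ m]) auto
    qed
  qed
  with zero show ?thesis by auto
qed

text \<open>Vanishing autocorrelation sums determine the partial products of the left-hand side over
  the first \<open>m\<close> indices; comparing consecutive \<open>m\<close> isolates each
  factor.\<close>

lemma golay_2_phase_symmetry:
  assumes s: "s > 1"
    and ph: "\<And>k. k \<in> {0..<int s} \<Longrightarrow> A k \<in> {1, -1}" "\<And>k. k \<in> {0..<int s} \<Longrightarrow> B k \<in> {1, -1}"
    and supp: "supported s A" "supported s B"
    and corr: "\<And>a. a \<noteq> 0 \<Longrightarrow> seq_corr s A A a + seq_corr s B B a = 0"
    and k: "k \<in> {0..<int s}"
  shows "A k * B k * (A (int s - 1 - k) * B (int s - 1 - k)) = -1"
proof -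
  define y where "y k = A k * B k * (A (int s - 1 - k) * B (int s - 1 - k))" for k
  have cnj: "cnj (A k) = A k" "cnj (B k) = B k" if "k \<in> {0..<int s}" for k
    using ph[OF that] by auto
  text \<open>The autocorrelations at shift \<open>s - m\<close> have \<open>m\<close> terms each.\<close>
  have prod_y: "(\<Prod>i\<in>{0..<int m}. y i) = (-1) ^ m" if m: "m < s" for m
  proof -
    define u where "u = int s - int m"
    have u: "u > 0" using m by (simp add: u_def)
    have trunc: "seq_corr s X X u = (\<Sum>i\<in>{0..<int m}. X i * cnj (X (i + u)))"
      if "supported s X" for X
      unfolding seq_corr_def
      by (rule sum.mono_neutral_right) (use that m in \<open>auto simp: supported_def u_def\<close>)
    have "(\<Prod>i\<in>{0..<int m}. (A i * A (i + u)) * (B i * B (i + u))) = (-1) ^ card {0..<int m}"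
    proof (rule prod_eq_if_sum_zero)
      show "A i * A (i + u) \<in> {1, -1} \<and> B i * B (i + u) \<in> {1, -1}" if "i \<in> {0..<int m}" for i
        using that m ph[of i] ph[of "i + u"] by (auto simp: u_def)
      have "(\<Sum>i\<in>{0..<int m}. A i * A (i + u) + B i * B (i + u)) =
          seq_corr s A A u + seq_corr s B B u"
        unfolding trunc[OF supp(1)] trunc[OF supp(2)] sum.distrib [symmetric]
        by (intro sum.cong refl) (use m cnj in \<open>auto simp: u_def\<close>)
      then show "(\<Sum>i\<in>{0..<int m}. A i * A (i + u) + B i * B (i + u)) = 0"
        using corr[of u] u by simp
    qed simp
    also have "(\<Prod>i\<in>{0..<int m}. (A i * A (i + u)) * (B i * B (i + u))) =
        (\<Prod>i\<in>{0..<int m}. A i * B i) * (\<Prod>i\<in>{0..<int m}. A (i + u) * B (i + u))"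
      by (simp add: prod.distrib algebra_simps)
    \<comment> \<open>Both sides run over the last \<open>m\<close> entries, in opposite
      orders.\<close>
    also have "(\<Prod>i\<in>{0..<int m}. A (i + u) * B (i + u)) =
        (\<Prod>i\<in>{0..<int m}. A (int s - 1 - i) * B (int s - 1 - i))"
      by (rule prod.reindex_bij_witness [where i = "\<lambda>i. int m - 1 - i" and j = "\<lambda>i. int m - 1 - i"])
        (auto simp: u_def algebra_simps)
    finally show ?thesis by (simp add: y_def prod.distrib)
  qed
  \<comment> \<open>Divide the products for \<open>m = i + 1\<close> and \<open>m = i\<close>. As
    \<open>prod_y\<close> requires \<open>m < s\<close>, the last index is left to the reflection
    symmetry of \<open>y\<close>.\<close>
  have y_less: "y i = -1" if i: "0 \<le> i" "i < int s - 1" for i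
  proof -
    have "{0..<int (Suc (nat i))} = insert i {0..<int (nat i)}" using i by auto
    then have "(\<Prod>j\<in>{0..<int (Suc (nat i))}. y j) = y i * (\<Prod>j\<in>{0..<int (nat i)}. y j)"
      using i by simp
    moreover have "Suc (nat i) < s" "nat i < s" using i by linarith+
    ultimately have "y i * (-1) ^ nat i = (-1) * (-1) ^ nat i"
      using prod_y[of "Suc (nat i)"] prod_y[of "nat i"] by (metis power_Suc)
    then show ?thesis by (subst (asm) mult_cancel_right) simp
  qed
  have "y k = -1"
  proof (cases "k < int s - 1")
    case True
    then show ?thesis using k y_less by auto
  next
    case False
    then have "k = int s - 1" using k by auto
    then have "y k = y 0" by (simp add: y_def)
    then show ?thesis using y_less[of 0] s by simp
  qed
  then show ?thesis by (simp add: y_def)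
qed

section \<open>The construction\<close>

text \<open>In this form, closure under products, conjugation and, for even \<open>H\<close>,
  negation is immediate.\<close>

lemma phases_eq_roots_of_unity:
  assumes "H \<ge> 1"
  shows "phases H = {z. z ^ H = 1}"
  unfolding complex_roots_unity[OF assms] phases_def exp_of_nat_mult [symmetric]
  by (simp add: mult_ac)

text \<open>Exactly one of \<open>a = b\<close> and \<open>a' = b'\<close> holds. In the first case
  \<open>y = 0\<close> and \<open>x = a * f - a' * g\<close>; in the second \<open>x = 0\<close> and
  \<open>y = a * f + a' * g\<close>.\<close>

lemma one_nonzero_half_sum_diff:
  fixes a b a' b' f g :: complex
  assumes "a \<in> {1, -1}" "b \<in> {1, -1}" "a' \<in> {1, -1}" "b' \<in> {1, -1}" "a * b * (a' * b') = -1"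
    and "f + g \<in> S" "f - g \<in> S" and neg: "\<And>z. z \<in> S \<Longrightarrow> - z \<in> S"
  defines "x \<equiv> (a + b) / 2 * f - (a' - b') / 2 * g"
    and "y \<equiv> (a - b) / 2 * f + (a' + b') / 2 * g"
  shows "x \<in> S \<and> y = 0 \<or> x = 0 \<and> y \<in> S"
proof -
  have "- f - g \<in> S" "g - f \<in> S"
    using neg[OF assms(6)] neg[OF assms(7)] by simp_all
  then show ?thesis
    using assms(1-7) unfolding x_def y_def by (auto simp: add.commute)
qed

lemma golay_array_pair_extend:
  assumes H: "even H" "H \<ge> 2"
    and FG: "golay_array_pair H ns F G"
    and AB: "golay_sequence_pair 2 s A B" and s: "s > 1"
    and CD: "golay_sequence_pair H t C D"
  shows "\<exists>P Q. golay_array_pair H (t # s # ns) P Q"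
proof -
  obtain a b where a: "supported s a" "\<And>k. k \<in> {0..<int s} \<Longrightarrow> a k \<in> {1, -1}"
    and b: "supported s b" "\<And>k. k \<in> {0..<int s} \<Longrightarrow> b k \<in> {1, -1}"
    and ab: "\<And>x. x \<noteq> 0 \<Longrightarrow> seq_corr s a a x + seq_corr s b b x = 0"
    using golay_sequence_pairE[OF AB] unfolding phases_2 by metis
  obtain c d where c: "supported t c" "\<And>k. k \<in> {0..<int t} \<Longrightarrow> c k \<in> phases H"
    and d: "supported t d" "\<And>k. k \<in> {0..<int t} \<Longrightarrow> d k \<in> phases H"
    and cd: "\<And>x. x \<noteq> 0 \<Longrightarrow> seq_corr t c c x + seq_corr t d d x = 0"
    using golay_sequence_pairE[OF CD] by metis
  have phase_uminus: "- z \<in> phases H" if "z \<in> phases H" for z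
    using that H by (auto simp: phases_eq_roots_of_unity)
  have phase_cnj: "cnj z \<in> phases H" if "z \<in> phases H" for z
    using that H by (auto simp: phases_eq_roots_of_unity simp flip: complex_cnj_power)
  have phase_mult: "z * w \<in> phases H" if "z \<in> phases H" "w \<in> phases H" for z w
    using that H by (auto simp: phases_eq_roots_of_unity power_mult_distrib)

  define U V where "U k = (a k + b k) / 2" and "V k = (a k - b k) / 2" for k
  define f g where "f i = (F i + G i) / 2" and "g i = (F i - G i) / 2" for i
  \<comment> \<open>With this sign, \<open>E\<close> is
    \<open>U \<otimes> f - V* \<otimes> g\<close> and \<open>E'\<close> is
    \<open>V \<otimes> f + U* \<otimes> g\<close>, where \<open>*\<close> denotes conjugate
    reversal.\<close>
  define V' where "V' = (\<lambda>k. - conj_rev s V k)"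
  define E E' where "E = tensor_sum U f V' g"
    and "E' = tensor_sum (\<lambda>k. - conj_rev s V' k) f (conj_rev s U) g"
  define P Q where "P = tensor_sum c E d E'"
    and "Q = tensor_sum (\<lambda>k. - conj_rev t d k) E (conj_rev t c) E'"

  have UV: "supported s U" "supported s V" "supported s V'"
    using a(1) b(1) by (auto simp: U_def V_def V'_def supported_def conj_rev_def)
  have V'V: "conj_rev s V' = (\<lambda>k. - V k)"
    by (simp add: V'_def conj_rev_uminus)

  have corr: "box_corr (t # s # ns) P P (x # y # u) + box_corr (t # s # ns) Q Q (x # y # u) =
      (seq_corr t c c x + seq_corr t d d x) * (seq_corr s a a y + seq_corr s b b y) *
      (box_corr ns F F u + box_corr ns G G u) / 4" for x y u
  proof -
    have "box_corr (t # s # ns) P P (x # y # u) + box_corr (t # s # ns) Q Q (x # y # u) =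
      (seq_corr t c c x + seq_corr t d d x) * (seq_corr s U U y + seq_corr s V' V' y) *
      (box_corr ns f f u + box_corr ns g g u)"
      unfolding P_def Q_def E_def E'_def using c(1) d(1) UV
      by (simp add: box_corr_tensor_sum_pair)
    also have "seq_corr s V' V' y = seq_corr s V V y"
      using UV by (simp add: V'_def seq_corr_uminus_left seq_corr_uminus_right seq_corr_conj_rev)
    also have "seq_corr s U U y + seq_corr s V V y = (seq_corr s a a y + seq_corr s b b y) / 2"
      unfolding U_def V_def by (rule seq_corr_half_sum_diff)
    also have "box_corr ns f f u + box_corr ns g g u =
        (box_corr ns F F u + box_corr ns G G u) / 2"
      unfolding f_def g_def by (rule box_corr_half_sum_diff)
    finally show ?thesis by simp
  qed

  have FG_ph: "phase_array H ns F" "phase_array H ns G"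
    using FG by (auto simp: golay_array_pair_def)
  have fg: "f j + g j \<in> phases H" "f j - g j \<in> phases H" if "j \<in> index_box ns" for j
  proof -
    have "f j + g j = F j" "f j - g j = G j" by (simp_all add: f_def g_def field_simps)
    then show "f j + g j \<in> phases H" "f j - g j \<in> phases H"
      using FG_ph that by (simp_all add: phase_array_def)
  qed
  have E_in: "E i \<in> phases H \<and> E' i = 0 \<or> E i = 0 \<and> E' i \<in> phases H"
    if i: "i \<in> index_box (s # ns)" for i
  proof -
    obtain k j where i_eq: "i = k # j" and k: "k \<in> {0..<int s}" and j: "j \<in> index_box ns"
      using i by (cases i) auto
    define k' where "k' = int s - 1 - k"
    have k': "k' \<in> {0..<int s}" using k by (auto simp: k'_def)
    have "a k * b k * (a k' * b k') = -1"
      unfolding k'_def using golay_2_phase_symmetry[OF s a(2) b(2) a(1) b(1) ab k] .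
    moreover have "cnj (a k') = a k'" "cnj (b k') = b k'"
      using a(2)[OF k'] b(2)[OF k'] by auto
    then have "E i = U k * f j - V k' * g j" "E' i = V k * f j + U k' * g j"
      unfolding E_def E'_def i_eq V'V V'_def
      by (simp_all add: conj_rev_def U_def V_def k'_def [symmetric])
    ultimately show ?thesis
      using one_nonzero_half_sum_diff[OF a(2)[OF k] b(2)[OF k] a(2)[OF k'] b(2)[OF k'],
          of "f j" "g j" "phases H"] fg[OF j] phase_uminus
      by (simp add: U_def V_def)
  qed
  have tensor_sum_outside: "tensor_sum X K Y L i = 0"
    if "supported n X" "supported n Y" "i \<notin> index_box (n # m)"
      "\<And>i. i \<notin> index_box m \<Longrightarrow> K i = 0" "\<And>i. i \<notin> index_box m \<Longrightarrow> L i = 0" for n m X Y K L i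
    using that by (cases i) (auto simp: supported_def)
  have E_out: "E i = 0" "E' i = 0" if "i \<notin> index_box (s # ns)" for i
    unfolding E_def E'_def using FG_ph UV that
    by (auto intro!: tensor_sum_outside supported_uminus supported_conj_rev
        simp: f_def g_def phase_array_def)
  \<comment> \<open>Stated for arbitrary phase sequences to serve both \<open>P\<close> and
    \<open>Q\<close>. By \<open>E_in\<close> each entry is a single product of two phases.\<close>
  have PQ_ph: "phase_array H (t # s # ns) (tensor_sum X E Y E')"
    if "supported t X" "supported t Y" "\<And>k. k \<in> {0..<int t} \<Longrightarrow> X k \<in> phases H"
      "\<And>k. k \<in> {0..<int t} \<Longrightarrow> Y k \<in> phases H" for X Y
    unfolding phase_array_def
  proof (intro conjI ballI allI impI)
    fix i assume "i \<in> index_box (t # s # ns)"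
    then obtain k j where i_eq: "i = k # j" and "k \<in> {0..<int t}" "j \<in> index_box (s # ns)"
      by (cases i) auto
    then show "tensor_sum X E Y E' i \<in> phases H"
      using that E_in[of j] phase_mult by auto
  qed (use that E_out in \<open>auto intro!: tensor_sum_outside\<close>)
  have conj_rev_ph: "conj_rev t X k \<in> phases H"
    if "\<And>k. k \<in> {0..<int t} \<Longrightarrow> X k \<in> phases H" "k \<in> {0..<int t}" for X k
    unfolding conj_rev_def using that by (intro phase_cnj) auto

  have "golay_array_pair H (t # s # ns) P Q"
    unfolding golay_array_pair_iff
  proof (intro conjI allI impI)
    show "phase_array H (t # s # ns) P" "phase_array H (t # s # ns) Q"
      unfolding P_def Q_def using c d
      by (auto intro!: PQ_ph phase_uminus conj_rev_ph supported_uminus supported_conj_rev)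
    fix v :: "int list"
    assume v: "length v = length (t # s # ns) \<and> v \<noteq> replicate (length (t # s # ns)) 0"
    then obtain x y u where v_eq: "v = x # y # u" and "length u = length ns"
      and "x \<noteq> 0 \<or> y \<noteq> 0 \<or> u \<noteq> replicate (length ns) 0"
      by (auto simp: length_Suc_conv)
    \<comment> \<open>Whichever part of the shift is nonzero, the corresponding factor in
      \<open>corr\<close> vanishes.\<close>
    then show "box_corr (t # s # ns) P P v + box_corr (t # s # ns) Q Q v = 0"
      unfolding v_eq corr using ab cd FG by (auto simp: golay_array_pair_iff)
  qed
  then show ?thesis by blast
qed

text \<open>Induction from the right end of the size list: a single \<open>H\<close>-phase pair is
  the base, and each step puts one \<open>t\<close> and one \<open>s\<close> in front.\<close>

lemma golay_array_pair_splice: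
  assumes "even H" "H \<ge> 2" and "length ts = Suc (length ss)"
    and "\<And>s. s \<in> set ss \<Longrightarrow> s > 1 \<and> (\<exists>A B. golay_sequence_pair 2 s A B)"
    and "\<And>t. t \<in> set ts \<Longrightarrow> \<exists>C D. golay_sequence_pair H t C D"
  shows "\<exists>F G. golay_array_pair H (splice ts ss) F G"
  using assms(3-)
proof (induction ss arbitrary: ts)
  case Nil
  then show ?case by (auto simp: length_Suc_conv)
next
  case (Cons s ss)
  then obtain t ts' where ts: "ts = t # ts'" "length ts' = Suc (length ss)"
    by (auto simp: length_Suc_conv)
  with Cons obtain F G where "golay_array_pair H (splice ts' ss) F G"
    by fastforce
  moreover obtain A B where "golay_sequence_pair 2 s A B" "s > 1"
    using Cons.prems(2)[of s] by auto
  moreover obtain C D where "golay_sequence_pair H t C D"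
    using Cons.prems(3)[of t] ts by auto
  ultimately show ?case
    using golay_array_pair_extend[OF assms(1,2)] ts by fastforce
qed

theorem theorem3:
  fixes H r :: nat and s t :: "nat \<Rightarrow> nat"
    and A B C D :: "nat \<Rightarrow> int list \<Rightarrow> complex"
  assumes "even H" and "H \<ge> 2" and "r \<ge> 1"
    and "\<And>k. 1 \<le> k \<Longrightarrow> k \<le> r \<Longrightarrow> golay_sequence_pair 2 (s k) (A k) (B k)"
    and "\<And>k. 1 \<le> k \<Longrightarrow> k \<le> r \<Longrightarrow> s k > 1"
    and "\<And>k. 1 \<le> k \<Longrightarrow> k \<le> r + 1 \<Longrightarrow> golay_sequence_pair H (t k) (C k) (D k)"
  shows "\<exists>F G. golay_array_pair H (splice (map t [1..<r+2]) (map s [1..<r+1])) F G"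
proof (rule golay_array_pair_splice[OF assms(1,2)])
  show "length (map t [1..<r+2]) = Suc (length (map s [1..<r+1]))"
    by simp
  show "x > 1 \<and> (\<exists>A B. golay_sequence_pair 2 x A B)" if "x \<in> set (map s [1..<r+1])" for x
  proof -
    from that obtain k where "x = s k" "k \<in> {1..<r+1}"
      unfolding set_map set_upt by (rule imageE)
    then show ?thesis using assms(4,5)[of k] by auto
  qed
  show "\<exists>C D. golay_sequence_pair H x C D" if "x \<in> set (map t [1..<r+2])" for x
  proof -
    from that obtain k where "x = t k" "k \<in> {1..<r+2}"
      unfolding set_map set_upt by (rule imageE)
    then show ?thesis using assms(6)[of k] by auto
  qed
qed

end
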